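(* Let $L/K$ be a totally ramified Kummer extension of local fields whose degree is a power of the residue characteristic $p$ of $K$. Then $\mathrm{VC}(L/K)$ holds if and only if $L$ is a unit root Kummer extension of $K$.
   Context: A local field is a field complete with respect to a discrete valuation; $v_K,v_L$ are the normalized valuations. $L/K$ is a Kummer extension if $L/K$ is Galois with $\mathrm{Gal}(L/K)$ abelian of exponent $m$ and $K$ contains a primitive $m$-th root of unity; then, with $W=L^{*m}\cap K^*$, one has $L=K(\sqrt[m]{W})$. $L/K$ is a unit root Kummer extension if moreover $v_K(W)\subset m\mathbb{Z}$. An element $x\in L$ is normal over $K$ if its $\mathrm{Gal}(L/K)$-conjugates form a $K$-basis of $L$. With $d_{L/K}$ the valuation in $L$ of the different of $L/K$ and $e_{L/K}$ the ramification index, $\mathrm{VC}(L/K)$ is the statement: every $x\in L^*$ with $v_L(x)\equiv -d_{L/K}-1\pmod{e_{L/K}}$ is normal over $K$. *)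

theory Defs
  imports Complex_Main "HOL-Number_Theory.Cong"
begin

text \<open>
  A normalized discrete valuation is a function into \<^typ>\<open>int\<close> whose value at \<open>0\<close>
  (conventionally infinite) is irrelevant: no definition below depends on it.
\<close>

locale normalized_discrete_valuation =
  fixes v :: "'a::field \<Rightarrow> int"
  assumes val_mult: "x \<noteq> 0 \<Longrightarrow> y \<noteq> 0 \<Longrightarrow> v (x * y) = v x + v y"
    and val_add: "x \<noteq> 0 \<Longrightarrow> y \<noteq> 0 \<Longrightarrow> x + y \<noteq> 0 \<Longrightarrow> min (v x) (v y) \<le> v (x + y)"
    and val_surj: "v ` (- {0}) = UNIV"

definition val_ideal :: "('a::field \<Rightarrow> int) \<Rightarrow> int \<Rightarrow> 'a set" where
  "val_ideal v N = {x. x = 0 \<or> N \<le> v x}"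

abbreviation val_ring :: "('a::field \<Rightarrow> int) \<Rightarrow> 'a set" where
  "val_ring v \<equiv> val_ideal v 0"

abbreviation max_ideal :: "('a::field \<Rightarrow> int) \<Rightarrow> 'a set" where
  "max_ideal v \<equiv> val_ideal v 1"

definition val_cauchy :: "('a::field \<Rightarrow> int) \<Rightarrow> (nat \<Rightarrow> 'a) \<Rightarrow> bool" where
  "val_cauchy v s \<longleftrightarrow> (\<forall>N. \<exists>n0. \<forall>i\<ge>n0. \<forall>j\<ge>n0. s i - s j \<in> val_ideal v N)"

definition val_limit :: "('a::field \<Rightarrow> int) \<Rightarrow> (nat \<Rightarrow> 'a) \<Rightarrow> 'a \<Rightarrow> bool" where
  "val_limit v s l \<longleftrightarrow> (\<forall>N. \<exists>n0. \<forall>i\<ge>n0. s i - l \<in> val_ideal v N)"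

locale local_field = normalized_discrete_valuation v for v :: "'a::field \<Rightarrow> int" +
  assumes complete: "val_cauchy v s \<Longrightarrow> \<exists>l. val_limit v s l"

text \<open>
  The characteristic of the residue field \<open>val_ring v / max_ideal v\<close>: the non-negative generator
  of the ideal of those integers that vanish in it.
\<close>

definition residue_char :: "('a::field \<Rightarrow> int) \<Rightarrow> nat" where
  "residue_char v = Gcd {n. of_nat n \<in> max_ideal v}"


text \<open>
  An extension \<open>L/K\<close> is given by a field homomorphism \<open>\<iota> :: 'k \<Rightarrow> 'l\<close>; then \<open>L = 'l\<close> is a
  \<open>K\<close>-vector space with scalar multiplication \<open>scale_of \<iota>\<close>.
\<close>

definition field_hom :: "('k::field \<Rightarrow> 'l::field) \<Rightarrow> bool" where
  "field_hom f \<longleftrightarrow> f 1 = 1 \<and> (\<forall>x y. f (x + y) = f x + f y) \<and> (\<forall>x y. f (x * y) = f x * f y)"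

definition scale_of :: "('k::field \<Rightarrow> 'l::field) \<Rightarrow> 'k \<Rightarrow> 'l \<Rightarrow> 'l" where
  "scale_of \<iota> a x = \<iota> a * x"

definition is_basis :: "('k::field \<Rightarrow> 'l::field) \<Rightarrow> 'l set \<Rightarrow> bool" where
  "is_basis \<iota> B \<longleftrightarrow> \<not> module.dependent (scale_of \<iota>) B \<and> module.span (scale_of \<iota>) B = UNIV"

definition finite_extension :: "('k::field \<Rightarrow> 'l::field) \<Rightarrow> bool" where
  "finite_extension \<iota> \<longleftrightarrow> field_hom \<iota> \<and> (\<exists>B. finite B \<and> is_basis \<iota> B)"

definition ext_degree :: "('k::field \<Rightarrow> 'l::field) \<Rightarrow> nat" where
  "ext_degree \<iota> = vector_space.dim (scale_of \<iota>) UNIV"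

definition gal :: "('k::field \<Rightarrow> 'l::field) \<Rightarrow> ('l \<Rightarrow> 'l) set" where
  "gal \<iota> = {\<sigma>. bij \<sigma> \<and> field_hom \<sigma> \<and> (\<forall>a. \<sigma> (\<iota> a) = \<iota> a)}"

definition galois :: "('k::field \<Rightarrow> 'l::field) \<Rightarrow> bool" where
  "galois \<iota> \<longleftrightarrow> finite_extension \<iota> \<and> {x. \<forall>\<sigma>\<in>gal \<iota>. \<sigma> x = x} = range \<iota>"

definition normal_over :: "('k::field \<Rightarrow> 'l::field) \<Rightarrow> 'l \<Rightarrow> bool" where
  "normal_over \<iota> x \<longleftrightarrow> is_basis \<iota> ((\<lambda>\<sigma>. \<sigma> x) ` gal \<iota>)"


definition has_exponent :: "('l \<Rightarrow> 'l) set \<Rightarrow> nat \<Rightarrow> bool" where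
  "has_exponent G m \<longleftrightarrow> m > 0 \<and> (\<forall>\<sigma>\<in>G. \<sigma> ^^ m = id) \<and>
     (\<forall>k. 0 < k \<and> k < m \<longrightarrow> (\<exists>\<sigma>\<in>G. \<sigma> ^^ k \<noteq> id))"

definition primitive_root_of_unity :: "nat \<Rightarrow> 'k::field \<Rightarrow> bool" where
  "primitive_root_of_unity m \<zeta> \<longleftrightarrow> m > 0 \<and> \<zeta> ^ m = 1 \<and> (\<forall>k. 0 < k \<and> k < m \<longrightarrow> \<zeta> ^ k \<noteq> 1)"

definition kummer_extension :: "('k::field \<Rightarrow> 'l::field) \<Rightarrow> nat \<Rightarrow> bool" where
  "kummer_extension \<iota> m \<longleftrightarrow> galois \<iota> \<and>
     (\<forall>\<sigma>\<in>gal \<iota>. \<forall>\<tau>\<in>gal \<iota>. \<sigma> \<circ> \<tau> = \<tau> \<circ> \<sigma>) \<and> has_exponent (gal \<iota>) m \<and>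
     (\<exists>\<zeta>::'k. primitive_root_of_unity m \<zeta>)"

definition kummer_group :: "('k::field \<Rightarrow> 'l::field) \<Rightarrow> nat \<Rightarrow> 'k set" where
  "kummer_group \<iota> m = {a. a \<noteq> 0 \<and> (\<exists>y. y \<noteq> 0 \<and> \<iota> a = y ^ m)}"

definition unit_root_kummer_extension ::
    "('k::field \<Rightarrow> int) \<Rightarrow> ('k \<Rightarrow> 'l::field) \<Rightarrow> nat \<Rightarrow> bool" where
  "unit_root_kummer_extension vK \<iota> m \<longleftrightarrow> kummer_extension \<iota> m \<and>
     vK ` kummer_group \<iota> m \<subseteq> {k. int m dvd k}"


definition local_field_extension ::
    "('k::field \<Rightarrow> int) \<Rightarrow> ('l::field \<Rightarrow> int) \<Rightarrow> ('k \<Rightarrow> 'l) \<Rightarrow> bool" where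
  "local_field_extension vK vL \<iota> \<longleftrightarrow> local_field vK \<and> local_field vL \<and> finite_extension \<iota> \<and>
     (\<exists>e>0. \<forall>a. a \<noteq> 0 \<longrightarrow> vL (\<iota> a) = e * vK a)"

definition ramification_index ::
    "('k::field \<Rightarrow> int) \<Rightarrow> ('l::field \<Rightarrow> int) \<Rightarrow> ('k \<Rightarrow> 'l) \<Rightarrow> int" where
  "ramification_index vK vL \<iota> = (THE e. \<forall>a. a \<noteq> 0 \<longrightarrow> vL (\<iota> a) = e * vK a)"

definition totally_ramified ::
    "('k::field \<Rightarrow> int) \<Rightarrow> ('l::field \<Rightarrow> int) \<Rightarrow> ('k \<Rightarrow> 'l) \<Rightarrow> bool" where
  "totally_ramified vK vL \<iota> \<longleftrightarrow> ramification_index vK vL \<iota> = int (ext_degree \<iota>)"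

text \<open>
  The trace as the sum of conjugates, hence only meaningful for Galois extensions; its values
  are elements of \<open>K\<close> viewed inside \<open>L\<close>.
\<close>

definition gal_trace :: "('k::field \<Rightarrow> 'l::field) \<Rightarrow> 'l \<Rightarrow> 'l" where
  "gal_trace \<iota> x = (\<Sum>\<sigma>\<in>gal \<iota>. \<sigma> x)"

definition codifferent ::
    "('k::field \<Rightarrow> int) \<Rightarrow> ('l::field \<Rightarrow> int) \<Rightarrow> ('k \<Rightarrow> 'l) \<Rightarrow> 'l set" where
  "codifferent vK vL \<iota> = {x. \<forall>y\<in>val_ring vL. gal_trace \<iota> (x * y) \<in> \<iota> ` val_ring vK}"

text \<open>The different is the inverse of the codifferent as a fractional ideal.\<close>

definition different ::
    "('k::field \<Rightarrow> int) \<Rightarrow> ('l::field \<Rightarrow> int) \<Rightarrow> ('k \<Rightarrow> 'l) \<Rightarrow> 'l set" where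
  "different vK vL \<iota> = {z. \<forall>x\<in>codifferent vK vL \<iota>. z * x \<in> val_ring vL}"

definition different_exponent ::
    "('k::field \<Rightarrow> int) \<Rightarrow> ('l::field \<Rightarrow> int) \<Rightarrow> ('k \<Rightarrow> 'l) \<Rightarrow> int" where
  "different_exponent vK vL \<iota> = (THE d. different vK vL \<iota> = val_ideal vL d)"

definition VC :: "('k::field \<Rightarrow> int) \<Rightarrow> ('l::field \<Rightarrow> int) \<Rightarrow> ('k \<Rightarrow> 'l) \<Rightarrow> bool" where
  "VC vK vL \<iota> \<longleftrightarrow> (\<forall>x. x \<noteq> 0 \<and>
     [vL x = - different_exponent vK vL \<iota> - 1] (mod ramification_index vK vL \<iota>)
     \<longrightarrow> normal_over \<iota> x)"

end

theory Submission
  imports Defs "HOL-Computational_Algebra.Primes" "HOL-Computational_Algebra.Polynomial"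
    "HOL-Library.FuncSet"
begin

text \<open>
  Call \<open>y \<noteq> 0\<close> an eigenvector if \<open>\<sigma> y \<in> K y\<close> for all \<open>\<sigma>\<close>; equivalently \<open>y ^ m \<in> K\<close>. The
  eigenvectors span \<open>L\<close>, and the projection of \<open>x\<close> to the eigenline of \<open>1 / y\<close> is a multiple of
  \<open>Tr (x * y) / y\<close>, so \<open>x\<close> is normal iff \<open>Tr (x * y) \<noteq> 0\<close> for every eigenvector \<open>y\<close>. Moreover the
  extension is unit root iff \<open>n = [L : K]\<close> divides \<open>vL y\<close> for every eigenvector \<open>y\<close>.

  Since the residue fields agree, the definition of the different shows that \<open>Tr z \<noteq> 0\<close> whenever
  \<open>vL z \<equiv> - d - 1 (mod n)\<close>. In every other residue class each valuation is attained by some \<open>z\<close>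
  with \<open>Tr z = 0\<close>: correct an arbitrary \<open>z\<close> by a multiple of an element of valuation \<open>- d - 1\<close>,
  which has larger valuation than \<open>z\<close>. Applying this to \<open>z = x * y\<close> gives both directions.
\<close>

section \<open>Arithmetic of discrete valuations\<close>

context normalized_discrete_valuation
begin

lemma val_one [simp]: "v 1 = 0"
  using val_mult[of 1 1] by simp

lemma val_minus_one [simp]: "v (- 1) = 0"
  using val_mult[of "-1" "-1"] by simp

lemma val_minus [simp]: "v (- x) = v x"
  using val_mult[of "-1" x] by (cases "x = 0") auto

lemma val_inverse: "x \<noteq> 0 \<Longrightarrow> v (inverse x) = - v x"
  using val_mult[of x "inverse x"] by simp

lemma val_divide: "x \<noteq> 0 \<Longrightarrow> y \<noteq> 0 \<Longrightarrow> v (x / y) = v x - v y"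
  by (simp add: divide_inverse val_mult val_inverse)

lemma val_power: "x \<noteq> 0 \<Longrightarrow> v (x ^ k) = int k * v x"
  by (induction k) (auto simp: val_mult algebra_simps)

lemma obtain_val:
  obtains x where "x \<noteq> 0" "v x = j"
proof -
  have "j \<in> v ` (- {0})" using val_surj by simp
  then show thesis using that by auto
qed

lemma zero_in_val_ideal [simp]: "0 \<in> val_ideal v N"
  by (simp add: val_ideal_def)

lemma val_ideal_add: "x \<in> val_ideal v N \<Longrightarrow> y \<in> val_ideal v N \<Longrightarrow> x + y \<in> val_ideal v N"
  using val_add[of x y] by (cases "x = 0"; cases "y = 0"; cases "x + y = 0") (auto simp: val_ideal_def)

lemma val_ideal_sum: "(\<And>i. i \<in> A \<Longrightarrow> f i \<in> val_ideal v N) \<Longrightarrow> sum f A \<in> val_ideal v N"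
  by (induction A rule: infinite_finite_induct) (auto intro: val_ideal_add)

lemma val_ideal_minus: "x \<in> val_ideal v N \<Longrightarrow> - x \<in> val_ideal v N"
  by (auto simp: val_ideal_def)

lemma val_ideal_mult: "x \<in> val_ideal v M \<Longrightarrow> y \<in> val_ideal v N \<Longrightarrow> x * y \<in> val_ideal v (M + N)"
  by (cases "x = 0"; cases "y = 0") (auto simp: val_ideal_def val_mult)

lemma val_ideal_mono: "x \<in> val_ideal v N \<Longrightarrow> M \<le> N \<Longrightarrow> x \<in> val_ideal v M"
  by (auto simp: val_ideal_def)

text \<open>If \<open>x + y\<close> had larger valuation than \<open>x\<close>, then
  \<open>x = (x + y) - y\<close> would contradict \<open>val_add\<close>. Stating the bound by
  \<open>val_ideal\<close> admits \<open>y = 0\<close>.\<close>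

lemma val_add_eq:
  assumes "x \<noteq> 0" "y \<in> val_ideal v (v x + 1)"
  shows "x + y \<noteq> 0 \<and> v (x + y) = v x"
proof (cases "y = 0")
  case False
  then have lt: "v x < v y" using assms by (auto simp: val_ideal_def)
  have nz: "x + y \<noteq> 0"
    using lt val_minus[of y] by (metis add_eq_0_iff2 less_irrefl)
  have "min (v x) (v y) \<le> v (x + y)"
    using val_add[of x y] assms False nz by simp
  moreover have "min (v (x + y)) (v (- y)) \<le> v x"
    using val_add[of "x + y" "- y"] assms False nz by simp
  ultimately show ?thesis using lt nz by auto
qed (use assms in auto)

text \<open>The term added in the induction never has the valuation of the partial sum, because the
  latter is one of the valuations already present; so \<open>val_add_eq\<close> applies, with one of
  the two dominating.\<close>

lemma val_sum_distinct:
  assumes "finite S" "S \<noteq> {}" "inj_on (\<lambda>s. v (f s)) S" "\<And>s. s \<in> S \<Longrightarrow> f s \<noteq> 0"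
  shows "sum f S \<noteq> 0 \<and> v (sum f S) \<in> (\<lambda>s. v (f s)) ` S \<and> (\<forall>s\<in>S. v (sum f S) \<le> v (f s))"
  using assms
proof (induction S rule: finite_ne_induct)
  case (insert s S)
  have IH: "sum f S \<noteq> 0" "v (sum f S) \<in> (\<lambda>s. v (f s)) ` S" "\<forall>s\<in>S. v (sum f S) \<le> v (f s)"
    using insert by auto
  have eq: "sum f (insert s S) = f s + sum f S" using insert by simp
  have ne: "v (f s) \<noteq> v (sum f S)"
    using IH(2) insert.prems(1) insert.hyps by (auto simp: inj_on_def)
  have fs: "f s \<noteq> 0" using insert.prems by auto
  consider "v (f s) < v (sum f S)" | "v (sum f S) < v (f s)" using ne by linarith
  then show ?case
  proof cases
    case 1
    then have "f s + sum f S \<noteq> 0 \<and> v (f s + sum f S) = v (f s)"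
      using fs by (intro val_add_eq) (auto simp: val_ideal_def)
    then show ?thesis using 1 IH(3) unfolding eq by fastforce
  next
    case 2
    then have "sum f S + f s \<noteq> 0 \<and> v (sum f S + f s) = v (sum f S)"
      using IH by (intro val_add_eq) (auto simp: val_ideal_def)
    then show ?thesis using 2 IH(2,3) unfolding eq by (simp add: add.commute)
  qed
qed auto

text \<open>Makes the exponent of a fractional ideal unique, as the definite description in
  \<open>different_exponent\<close> requires.\<close>

lemma val_ideal_eq_iff: "val_ideal v M = val_ideal v N \<longleftrightarrow> M = N"
proof
  assume eq: "val_ideal v M = val_ideal v N"
  obtain x where x: "x \<noteq> 0" "v x = M" by (rule obtain_val)
  obtain y where y: "y \<noteq> 0" "v y = N" by (rule obtain_val)
  have "x \<in> val_ideal v N" "y \<in> val_ideal v M"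
    using x y eq[symmetric] eq by (auto simp: val_ideal_def)
  then show "M = N" using x y by (auto simp: val_ideal_def)
qed simp

end

section \<open>The extension as a vector space over the base field\<close>

locale field_extension =
  fixes \<iota> :: "'k::field \<Rightarrow> 'l::field"
  assumes hom: "field_hom \<iota>"
begin

lemma hom_one [simp]: "\<iota> 1 = 1" and hom_add: "\<iota> (a + b) = \<iota> a + \<iota> b"
  and hom_mult: "\<iota> (a * b) = \<iota> a * \<iota> b"
  using hom by (auto simp: field_hom_def)

lemma hom_zero [simp]: "\<iota> 0 = 0"
  using hom_add[of 0 0] by (metis add_0 add_cancel_right_right)

lemma hom_minus: "\<iota> (- a) = - \<iota> a"
  using hom_add[of a "- a"] by (simp add: eq_neg_iff_add_eq_0 add.commute)

lemma hom_diff: "\<iota> (a - b) = \<iota> a - \<iota> b"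
  using hom_add[of a "- b"] by (simp add: hom_minus)

lemma hom_inverse: "\<iota> (inverse a) = inverse (\<iota> a)"
proof (cases "a = 0")
  case False
  then have "\<iota> a * \<iota> (inverse a) = 1" by (simp flip: hom_mult)
  then show ?thesis by (metis inverse_unique)
qed simp

lemma hom_power: "\<iota> (a ^ k) = \<iota> a ^ k"
  by (induction k) (auto simp: hom_mult)

lemma hom_eq_0_iff [simp]: "\<iota> a = 0 \<longleftrightarrow> a = 0"
proof
  assume "\<iota> a = 0"
  then have "\<iota> (a * inverse a) = 0" by (simp add: hom_mult)
  then show "a = 0" by (metis hom_one right_inverse zero_neq_one)
qed simp

lemma hom_eq_iff [simp]: "\<iota> a = \<iota> b \<longleftrightarrow> a = b"
  using hom_eq_0_iff[of "a - b"] by (simp add: hom_diff del: hom_eq_0_iff)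

lemma hom_sum: "\<iota> (sum f A) = (\<Sum>i\<in>A. \<iota> (f i))"
  by (induction A rule: infinite_finite_induct) (auto simp: hom_add)

sublocale vs: vector_space "scale_of \<iota>"
  by unfold_locales (auto simp: scale_of_def hom_add hom_mult algebra_simps)

end

section \<open>Totally ramified extensions and expansions in a uniformizer\<close>

text \<open>The same \<open>n\<close> in \<open>val_ext\<close> and \<open>card_B\<close> encodes
  that ramification index and degree coincide. The basis \<open>B\<close> is a parameter because the
  locale of finite-dimensional spaces takes a fixed one.\<close>

locale totally_ramified_extension = field_extension \<iota> +
  K: normalized_discrete_valuation vK + L: normalized_discrete_valuation vL
  for \<iota> :: "'k::field \<Rightarrow> 'l::field" and vK vL +
  fixes n :: nat and B :: "'l set"
  assumes n_pos: "n > 0"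
    and val_ext: "a \<noteq> 0 \<Longrightarrow> vL (\<iota> a) = int n * vK a"
    and finite_B: "finite B" and basis_B: "is_basis \<iota> B" and card_B: "card B = n"
begin

sublocale fd: finite_dimensional_vector_space "scale_of \<iota>" B
  using finite_B basis_B by unfold_locales (auto simp: is_basis_def)

definition unif :: 'l where
  "unif = (SOME x. x \<noteq> 0 \<and> vL x = 1)"

lemma unif [simp]: "unif \<noteq> 0" "vL unif = 1"
proof -
  have "\<exists>x. x \<noteq> 0 \<and> vL x = 1" by (metis L.obtain_val)
  then have "unif \<noteq> 0 \<and> vL unif = 1" unfolding unif_def by (rule someI_ex)
  then show "unif \<noteq> 0" "vL unif = 1" by auto
qed

lemma val_unif_power [simp]: "vL (unif ^ i) = int i"
  by (simp add: L.val_power)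

lemma val_scale: "a \<noteq> 0 \<Longrightarrow> x \<noteq> 0 \<Longrightarrow> vL (\<iota> a * x) = int n * vK a + vL x"
  by (simp add: L.val_mult val_ext)

text \<open>No cancellation can occur: the nonzero terms have valuations
  \<open>int n * vK (a i) + int i\<close>, which lie in different classes modulo
  \<open>n\<close>.\<close>

lemma val_expansion:
  assumes "i < n" "a i \<noteq> 0"
  defines "x \<equiv> \<Sum>i<n. \<iota> (a i) * unif ^ i"
  shows "x \<noteq> 0" "\<And>j. j < n \<Longrightarrow> \<iota> (a j) * unif ^ j \<in> val_ideal vL (vL x)"
proof -
  define S where "S = {i. i < n \<and> a i \<noteq> 0}"
  have S: "finite S" "S \<noteq> {}" using assms by (auto simp: S_def)
  have x: "x = (\<Sum>i\<in>S. \<iota> (a i) * unif ^ i)"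
    unfolding x_def S_def by (rule sum.mono_neutral_right) auto
  have val: "vL (\<iota> (a i) * unif ^ i) = int n * vK (a i) + int i" if "i \<in> S" for i
    using that by (simp add: S_def val_scale)
  have "inj_on (\<lambda>i. vL (\<iota> (a i) * unif ^ i)) S"
  proof (rule inj_onI)
    fix i j assume ij: "i \<in> S" "j \<in> S" "vL (\<iota> (a i) * unif ^ i) = vL (\<iota> (a j) * unif ^ j)"
    then have "int n * vK (a i) + int i = int n * vK (a j) + int j" by (simp add: val)
    then have "(int n * vK (a i) + int i) mod int n = (int n * vK (a j) + int j) mod int n" by simp
    then show "i = j" using ij by (simp add: S_def)
  qed
  from L.val_sum_distinct[OF S this] show nz: "x \<noteq> 0"
    and "\<And>j. j < n \<Longrightarrow> \<iota> (a j) * unif ^ j \<in> val_ideal vL (vL x)"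
    unfolding x by (auto simp: S_def val_ideal_def)
qed

text \<open>By \<open>val_expansion\<close> the powers \<open>unif ^ i\<close> with
  \<open>i < n\<close> are independent, and their number is the degree, so they form a K-basis; the
  bound on the terms comes from the same lemma.\<close>

lemma expansion:
  obtains a where "x = (\<Sum>i<n. \<iota> (a i) * unif ^ i)"
    "\<And>i. i < n \<Longrightarrow> \<iota> (a i) * unif ^ i \<in> val_ideal vL (vL x)"
proof -
  let ?P = "(\<lambda>i. unif ^ i) ` {..<n}"
  have inj: "inj_on (\<lambda>i. unif ^ i) {..<n}"
    by (rule inj_onI) (metis of_nat_eq_iff val_unif_power)
  have indep: "vs.independent ?P"
  proof (rule vs.independent_if_scalars_zero)
    fix f z assume sum0: "(\<Sum>x\<in>?P. scale_of \<iota> (f x) x) = 0" and "z \<in> ?P"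
    then obtain i where i: "i < n" "z = unif ^ i" by auto
    have "(\<Sum>i<n. \<iota> (f (unif ^ i)) * unif ^ i) = 0"
      using sum0 by (simp add: sum.reindex[OF inj] scale_of_def)
    then show "f z = 0"
      using val_expansion(1)[of i "\<lambda>i. f (unif ^ i)"] i by auto
  qed simp
  have "card ?P = n" using inj by (simp add: card_image)
  then have "UNIV \<subseteq> vs.span ?P"
    using indep by (intro fd.card_ge_dim_independent) (auto simp: fd.dim_UNIV fd.dimension_def card_B)
  then have "x \<in> vs.span ?P" by auto
  then obtain u where "(\<Sum>x\<in>?P. scale_of \<iota> (u x) x) = x"
    by (auto simp: vs.span_finite)
  then have x: "x = (\<Sum>i<n. \<iota> (u (unif ^ i)) * unif ^ i)"
    by (simp add: sum.reindex[OF inj] scale_of_def)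
  show thesis
  proof (rule that[OF x])
    fix j assume "j < n"
    then show "\<iota> (u (unif ^ j)) * unif ^ j \<in> val_ideal vL (vL x)"
      using val_expansion(2)[of j "\<lambda>i. u (unif ^ i)" j]
      by (cases "u (unif ^ j) = 0") (auto simp flip: x)
  qed
qed

text \<open>This expresses that the residue fields of K and L agree. In the expansion of the unit
  \<open>x / z\<close> all terms beyond the constant one have positive valuation, so the constant
  coefficient represents its residue class.\<close>

lemma residue_approx:
  assumes "x \<noteq> 0" "z \<noteq> 0" "vL x = vL z"
  obtains a w where "vK a = 0" "a \<noteq> 0" "w \<in> val_ideal vL (vL x + 1)" "x = \<iota> a * z + w"
proof -
  define u where "u = x / z"
  have u: "u \<noteq> 0" "vL u = 0" using assms by (auto simp: u_def L.val_divide)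
  obtain a where a: "u = (\<Sum>i<n. \<iota> (a i) * unif ^ i)"
    "\<And>i. i < n \<Longrightarrow> \<iota> (a i) * unif ^ i \<in> val_ideal vL 0"
    using expansion[of u] u by metis
  have higher: "\<iota> (a i) * unif ^ i \<in> val_ideal vL 1" if "i < n" "i > 0" for i
  proof (cases "a i = 0")
    case False
    then have "0 \<le> int n * vK (a i) + int i"
      using a(2)[OF that(1)] by (auto simp: val_ideal_def val_scale)
    moreover have "int n * vK (a i) + int i \<noteq> 0"
    proof
      assume "int n * vK (a i) + int i = 0"
      then have "(int n * vK (a i) + int i) mod int n = 0" by simp
      then show False using that by simp
    qed
    ultimately show ?thesis using False by (auto simp: val_ideal_def val_scale)
  qed simp
  define r where "r = (\<Sum>i\<in>{0<..<n}. \<iota> (a i) * unif ^ i)"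
  have r: "r \<in> val_ideal vL 1"
    unfolding r_def by (rule L.val_ideal_sum) (use higher in auto)
  have "{..<n} = insert 0 {0<..<n}" using n_pos by auto
  then have ur: "u = \<iota> (a 0) + r" unfolding a(1) r_def by simp
  have a0: "a 0 \<noteq> 0" using ur r u by (auto simp: val_ideal_def)
  have "vL (u + - r) = vL u"
    using L.val_add_eq[of u "- r"] u r by (auto intro: L.val_ideal_minus)
  then have "int n * vK (a 0) = 0" using ur a0 u by (simp flip: val_ext)
  then have va0: "vK (a 0) = 0" using n_pos by simp
  have "z \<in> val_ideal vL (vL x)" using assms by (simp add: val_ideal_def)
  then have "r * z \<in> val_ideal vL (vL x + 1)"
    using L.val_ideal_mult[OF r] by (metis add.commute)
  moreover have "x = \<iota> (a 0) * z + r * z"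
    using ur assms by (simp add: u_def field_simps)
  ultimately show thesis using that va0 a0 by blast
qed

end

section \<open>Integrality of linear functionals on fractional ideals\<close>

context totally_ramified_extension
begin

text \<open>A functional is determined by its finitely many values at powers of \<open>unif\<close>,
  and coefficients of large valuation outweigh their denominators.\<close>

lemma functional_integral_above:
  assumes add: "\<And>x y. T (x + y) = T x + T y" and scale: "\<And>a x. T (\<iota> a * x) = a * T x"
  obtains N where "\<And>x. x \<in> val_ideal vL N \<Longrightarrow> T x \<in> val_ring vK"
proof -
  have T0: "T 0 = 0" using add[of 0 0] by (metis add_0 add_cancel_right_right)
  have T_sum: "T (sum f A) = (\<Sum>i\<in>A. T (f i))" for f :: "nat \<Rightarrow> 'l" and A
    by (induction A rule: infinite_finite_induct) (auto simp: add T0)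
  \<comment> \<open>Where \<open>T (unif ^ i) = 0\<close>, the arbitrary value \<open>vK 0\<close>
    can only lower \<open>M\<close>, which does no harm since \<open>0\<close> lies in every
    \<open>val_ideal\<close>.\<close>
  define M where "M = Min ((\<lambda>i. vK (T (unif ^ i))) ` {..<n})"
  have M: "T (unif ^ i) \<in> val_ideal vK M" if "i < n" for i
    using that by (auto simp: val_ideal_def M_def)
  show thesis
  proof (rule that)
    \<comment> \<open>The summand \<open>int n\<close> absorbs the exponent \<open>i < n\<close> of
      \<open>unif\<close>, so that a nonzero coefficient \<open>a i\<close> has valuation above
      \<open>- M\<close>.\<close>
    fix x assume x: "x \<in> val_ideal vL (int n * (- M) + int n)"
    show "T x \<in> val_ring vK"
    proof (cases "x = 0")
      case False
      obtain a where a: "x = (\<Sum>i<n. \<iota> (a i) * unif ^ i)"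
        "\<And>i. i < n \<Longrightarrow> \<iota> (a i) * unif ^ i \<in> val_ideal vL (vL x)"
        using expansion[of x] by metis
      have "a i * T (unif ^ i) \<in> val_ring vK" if "i < n" for i
      proof -
        have "a i \<in> val_ideal vK (- M)"
        proof (cases "a i = 0")
          case False
          have "int n * (- M) + int n \<le> int n * vK (a i) + int i"
            using a(2)[OF that] x \<open>x \<noteq> 0\<close> False by (auto simp: val_ideal_def val_scale)
          then have "int n * (- M) < int n * vK (a i)" using that by linarith
          then have "- M < vK (a i)" by (meson mult_less_cancel_left_pos n_pos of_nat_0_less_iff)
          then show ?thesis by (simp add: val_ideal_def)
        qed simp
        then show ?thesis using K.val_ideal_mult[OF _ M[OF that]] by fastforce
      qed
      then have "(\<Sum>i<n. a i * T (unif ^ i)) \<in> val_ring vK"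
        by (intro K.val_ideal_sum) auto
      then show ?thesis by (subst a(1)) (simp add: T_sum scale)
    qed (simp add: T0)
  qed
qed

text \<open>
  The integer \<open>d\<close> found here is the exponent of the different when \<open>T\<close> is the trace.
\<close>

lemma functional_exponent:
  assumes add: "\<And>x y. T (x + y) = T x + T y" and scale: "\<And>a x. T (\<iota> a * x) = a * T x"
    and nonzero: "T x0 \<noteq> 0"
  obtains d where "{x. \<forall>y\<in>val_ring vL. T (x * y) \<in> val_ring vK} = val_ideal vL (- d)"
    and "\<And>x. x \<noteq> 0 \<Longrightarrow> [vL x = - d - 1] (mod int n) \<Longrightarrow> T x \<noteq> 0"
    and "\<And>j. \<not> [j = - d - 1] (mod int n) \<Longrightarrow> \<exists>z. z \<noteq> 0 \<and> vL z = j \<and> T z = 0"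
proof -
  have T0: "T 0 = 0" using add[of 0 0] by (metis add_0 add_cancel_right_right)
  \<comment> \<open>\<open>P\<close> holds for large arguments and fails for small ones. The
    threshold \<open>- d\<close> is found as a natural offset \<open>k\<close> from a point
    \<open>j1\<close> of failure, since the integers are not well-ordered.\<close>
  define P where "P j \<longleftrightarrow> (\<forall>z\<in>val_ideal vL j. T z \<in> val_ring vK)" for j
  obtain N where N: "P N"
    unfolding P_def using functional_integral_above[of T] add scale by metis
  have P_mono: "P i \<Longrightarrow> i \<le> j \<Longrightarrow> P j" for i j
    unfolding P_def using L.val_ideal_mono by blast
  \<comment> \<open>Scaling by \<open>c\<close> brings the nonzero value \<open>T x0\<close> to
    valuation \<open>-1\<close>, which makes \<open>P\<close> fail somewhere.\<close>
  obtain c where c: "c \<noteq> 0" "vK c = - vK (T x0) - 1" by (rule K.obtain_val)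
  have Tc: "T (\<iota> c * x0) \<notin> val_ring vK"
    using c nonzero by (simp add: scale val_ideal_def K.val_mult)
  define j1 where "j1 = min (vL (\<iota> c * x0)) N"
  have "\<iota> c * x0 \<in> val_ideal vL j1" by (simp add: val_ideal_def j1_def)
  then have j1: "\<not> P j1" unfolding P_def using Tc by blast
  define k where "k = (LEAST k. P (j1 + int k))"
  have "P (j1 + int (nat (N - j1)))" using N by (simp add: j1_def)
  then have Pk: "P (j1 + int k)" unfolding k_def by (rule LeastI)
  have "k \<noteq> 0" using Pk j1 by (metis add.right_neutral of_nat_0)
  then have "k - 1 < k" by simp
  then have "\<not> P (j1 + int (k - 1))" unfolding k_def by (rule not_less_Least)
  then have nPk: "\<not> P (j1 + int k - 1)" using \<open>k \<noteq> 0\<close> by (simp add: of_nat_diff algebra_simps)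
  define d where "d = - (j1 + int k)"
  have P: "P (- d)" and nP: "\<not> P (- d - 1)"
    using Pk nPk by (simp_all add: d_def add.commute)
  \<comment> \<open>A \<open>z\<close> witnessing \<open>\<not> P (- d - 1)\<close> has valuation
    exactly \<open>- d - 1\<close>, hence is a unit of K times \<open>x\<close> plus a term on which
    \<open>T\<close> is integral; so integrality of \<open>T x\<close> would pass to
    \<open>T z\<close>.\<close>
  have nonint: "T x \<notin> val_ring vK" if x: "x \<noteq> 0" "vL x = - d - 1" for x
  proof
    assume Tx: "T x \<in> val_ring vK"
    obtain z where z: "z \<in> val_ideal vL (- d - 1)" "T z \<notin> val_ring vK"
      using nP by (auto simp: P_def)
    have z0: "z \<noteq> 0" using z T0 by auto
    have vz: "vL z = - d - 1"
    proof (rule ccontr)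
      assume "vL z \<noteq> - d - 1"
      then have "z \<in> val_ideal vL (- d)" using z z0 by (auto simp: val_ideal_def)
      then show False using P z by (auto simp: P_def)
    qed
    obtain a w where aw: "vK a = 0" "a \<noteq> 0" "w \<in> val_ideal vL (vL z + 1)" "z = \<iota> a * x + w"
      using residue_approx[of z x] z0 x vz by metis
    have "T w \<in> val_ring vK" using P aw(3) vz by (simp add: P_def)
    moreover have "a * T x \<in> val_ring vK"
      using K.val_ideal_mult[of a 0 "T x" 0] aw Tx by (simp add: val_ideal_def)
    ultimately have "T z \<in> val_ring vK" by (simp add: aw(4) add scale K.val_ideal_add)
    then show False using z by simp
  qed
  show thesis
  proof (rule that[of d])
    show "{x. \<forall>y\<in>val_ring vL. T (x * y) \<in> val_ring vK} = val_ideal vL (- d)"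
    proof (intro set_eqI iffI)
      fix x assume "x \<in> {x. \<forall>y\<in>val_ring vL. T (x * y) \<in> val_ring vK}"
      then have x: "\<And>y. y \<in> val_ring vL \<Longrightarrow> T (x * y) \<in> val_ring vK" by auto
      show "x \<in> val_ideal vL (- d)"
      proof (rule ccontr)
        assume nx: "x \<notin> val_ideal vL (- d)"
        then have x0: "x \<noteq> 0" and vx: "vL x \<le> - d - 1" by (auto simp: val_ideal_def)
        obtain u where u: "u \<noteq> 0" "vL u = - d - 1" by (rule L.obtain_val)
        have "u / x \<in> val_ring vL" using u x0 vx by (auto simp: val_ideal_def L.val_divide)
        from x[OF this] have "T u \<in> val_ring vK" using x0 by simp
        then show False using nonint u by blast
      qed
    next
      fix x assume x: "x \<in> val_ideal vL (- d)"
      show "x \<in> {x. \<forall>y\<in>val_ring vL. T (x * y) \<in> val_ring vK}"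
      proof (intro CollectI ballI)
        fix y assume "y \<in> val_ring vL"
        then have "x * y \<in> val_ideal vL (- d)" using L.val_ideal_mult[OF x] by fastforce
        then show "T (x * y) \<in> val_ring vK" using P by (simp add: P_def)
      qed
    qed
  next
    fix x assume x: "x \<noteq> 0" "[vL x = - d - 1] (mod int n)"
    then obtain k where k: "- d - 1 = vL x + int n * k" by (auto simp: cong_iff_lin)
    obtain c where c: "c \<noteq> 0" "vK c = k" by (rule K.obtain_val)
    have "T (\<iota> c * x) \<notin> val_ring vK"
      using nonint[of "\<iota> c * x"] x k c by (simp add: val_scale)
    then show "T x \<noteq> 0" by (auto simp: scale)
  next
    fix j assume j: "\<not> [j = - d - 1] (mod int n)"
    define k where "k = (j + d) div int n"
    define r where "r = (j + d) mod int n"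
    have "int n * k + r = j + d" unfolding k_def r_def by (rule mult_div_mod_eq)
    then have jkr: "j = - d + int n * k + r" by simp
    have r: "0 \<le> r" "r < int n" using n_pos by (auto simp: r_def)
    \<comment> \<open>The remainder \<open>n - 1\<close> is precisely the excluded class of
      \<open>- d - 1\<close>; without it \<open>j\<close> stays strictly below
      \<open>int n * (k + 1) - d - 1\<close>.\<close>
    have "r \<noteq> int n - 1"
    proof
      assume "r = int n - 1"
      then have "- d - 1 = j + int n * (- k - 1)" using jkr by (simp add: algebra_simps)
      then show False using j unfolding cong_iff_lin by blast
    qed
    then have j_less: "j < int n * (k + 1) - d - 1"
      using jkr r by (simp add: algebra_simps)
    obtain z where z: "z \<noteq> 0" "vL z = j" by (rule L.obtain_val)
    show "\<exists>z. z \<noteq> 0 \<and> vL z = j \<and> T z = 0"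
    proof (cases "T z = 0")
      case False
      obtain c where c: "c \<noteq> 0" "vK c = - k" by (rule K.obtain_val)
      \<comment> \<open>Multiplication by \<open>c\<close> moves \<open>z\<close> to valuation
        \<open>r - d\<close>, where \<open>T\<close> is integral; undoing the scaling bounds
        \<open>vK (T z)\<close> below by \<open>k\<close>.\<close>
      have "\<iota> c * z \<in> val_ideal vL (- d)"
        using z c jkr r by (simp add: val_ideal_def val_scale)
      then have "c * T z \<in> val_ring vK" using P by (simp add: P_def flip: scale)
      then have Tz: "k \<le> vK (T z)" using c False by (auto simp: val_ideal_def K.val_mult)
      obtain u where u: "u \<noteq> 0" "vL u = - d - 1" by (rule L.obtain_val)
      have Tu: "T u \<noteq> 0" "vK (T u) \<le> - 1" using nonint[OF u] by (auto simp: val_ideal_def)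
      \<comment> \<open>This is the K-multiple of \<open>u\<close> with \<open>T w = T z\<close>.
        Since \<open>T u\<close> is not integral, \<open>w\<close> has valuation at least
        \<open>int n * (k + 1) - d - 1\<close>, above that of \<open>z\<close>, so subtracting it
        preserves the valuation of \<open>z\<close>.\<close>
      define w where "w = \<iota> (T z / T u) * u"
      have "vL w = int n * (vK (T z) - vK (T u)) - d - 1"
        using False Tu u by (simp add: w_def val_scale K.val_divide)
      moreover have "int n * (k + 1) \<le> int n * (vK (T z) - vK (T u))"
        using Tz Tu by (intro mult_left_mono) auto
      ultimately have "w \<in> val_ideal vL (vL z + 1)"
        using j_less z by (simp add: val_ideal_def)
      then have "z + - w \<noteq> 0 \<and> vL (z + - w) = vL z"
        using z by (intro L.val_add_eq L.val_ideal_minus)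
      moreover have "T (z + - w) = 0"
      proof -
        have "- w = \<iota> (- (T z / T u)) * u" by (simp add: w_def hom_minus)
        then have "T (- w) = - (T z / T u) * T u" by (simp only: scale)
        then show ?thesis using Tu by (simp add: add del: add_uminus_conv_diff)
      qed
      ultimately show ?thesis using z by metis
    qed (use z in auto)
  qed
qed

end

section \<open>Independence of characters, and roots of unity\<close>

text \<open>Substituting \<open>z * x\<close> for \<open>x\<close> and subtracting
  \<open>\<tau> z\<close> times the original relation eliminates \<open>\<tau>\<close>. A
  \<open>z\<close> with \<open>\<rho> z \<noteq> \<tau> z\<close> then kills the coefficient of
  \<open>\<rho>\<close>, and \<open>x = 1\<close> finally that of \<open>\<tau>\<close>.\<close>

lemma dedekind_independence:
  fixes a :: "('l::field \<Rightarrow> 'l) \<Rightarrow> 'l"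
  assumes "finite F" "\<And>\<sigma>. \<sigma> \<in> F \<Longrightarrow> field_hom \<sigma>" "\<And>x. (\<Sum>\<sigma>\<in>F. a \<sigma> * \<sigma> x) = 0" "\<sigma> \<in> F"
  shows "a \<sigma> = 0"
  using assms
proof (induction F arbitrary: a \<sigma> rule: finite_induct)
  case (insert \<tau> F)
  have other: "a \<rho> = 0" if \<rho>: "\<rho> \<in> F" for \<rho>
  proof -
    have "a \<rho> * (\<rho> z - \<tau> z) = 0" for z
    proof -
      define b where "b \<sigma> = a \<sigma> * (\<sigma> z - \<tau> z)" for \<sigma>
      have homF: "field_hom \<sigma>" if "\<sigma> \<in> F" for \<sigma>
        using insert.prems(1) that by blast
      have rel: "(\<Sum>\<sigma>\<in>F. b \<sigma> * \<sigma> x) = 0" for x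
      proof -
        have hm: "\<sigma> (z * x) = \<sigma> z * \<sigma> x" if "\<sigma> \<in> insert \<tau> F" for \<sigma>
          using insert.prems(1)[OF that] by (simp add: field_hom_def)
        have "0 = (\<Sum>\<sigma>\<in>insert \<tau> F. a \<sigma> * \<sigma> (z * x)) - \<tau> z * (\<Sum>\<sigma>\<in>insert \<tau> F. a \<sigma> * \<sigma> x)"
          by (simp only: insert.prems(2)) simp
        also have "\<dots> = (\<Sum>\<sigma>\<in>insert \<tau> F. a \<sigma> * (\<sigma> z - \<tau> z) * \<sigma> x)"
          unfolding sum_distrib_left sum_subtractf[symmetric]
          by (rule sum.cong[OF refl], simp only: hm) (simp add: algebra_simps)
        also have "\<dots> = (\<Sum>\<sigma>\<in>F. a \<sigma> * (\<sigma> z - \<tau> z) * \<sigma> x)" using insert.hyps by simp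
        finally show ?thesis by (simp add: b_def)
      qed
      show ?thesis
        using insert.IH[of b, OF homF rel \<rho>] by (simp add: b_def)
    qed
    moreover have "\<exists>z. \<rho> z \<noteq> \<tau> z" using \<rho> insert.hyps by (metis ext)
    ultimately show "a \<rho> = 0" by auto
  qed
  have "\<tau> 1 = 1" using insert.prems(1)[of \<tau>] by (simp add: field_hom_def)
  moreover have "(\<Sum>\<sigma>\<in>insert \<tau> F. a \<sigma> * \<sigma> 1) = a \<tau> * \<tau> 1"
    using insert.hyps other by simp
  ultimately have "a \<tau> = 0" using insert.prems(2)[of 1] by simp
  moreover from insert.prems(3) have "\<sigma> = \<tau> \<or> \<sigma> \<in> F" by (rule insertE) simp_all
  ultimately show ?case using other by metis
qed simp

text \<open>If the characteristic \<open>p\<close> divided \<open>m\<close>, Frobenius would give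
  \<open>(\<zeta> ^ (m div p) - 1) ^ p = 0\<close>, against primitivity. The eigenprojections below
  divide by \<open>of_nat m\<close>.\<close>

lemma primitive_root_of_nat_nonzero:
  fixes \<zeta> :: "'k::field"
  assumes "primitive_root_of_unity m \<zeta>"
  shows "of_nat m \<noteq> (0::'k)"
proof
  assume "of_nat m = (0::'k)"
  then have dvd: "CHAR('k) dvd m" by (simp add: of_nat_eq_0_iff_char_dvd)
  have m: "m > 0" "\<zeta> ^ m = 1" "\<And>k. 0 < k \<Longrightarrow> k < m \<Longrightarrow> \<zeta> ^ k \<noteq> 1"
    using assms by (auto simp: primitive_root_of_unity_def)
  have pos: "CHAR('k) > 0" using dvd m by (auto intro: Nat.gr0I)
  then have pr: "prime CHAR('k)" by (rule prime_CHAR_semidom)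
  obtain k where k: "m = CHAR('k) * k" using dvd by blast
  have "((\<zeta> ^ k - 1) + 1) ^ CHAR('k) = (\<zeta> ^ k - 1) ^ CHAR('k) + 1 ^ CHAR('k)"
    by (rule freshmans_dream) (use pr in auto)
  moreover have "((\<zeta> ^ k - 1) + 1) ^ CHAR('k) = 1"
    using m(2) by (simp add: k power_mult[symmetric] mult.commute)
  ultimately have "\<zeta> ^ k = 1" by simp
  moreover have "0 < k" "k < m" using m(1) k prime_gt_1_nat[OF pr] by auto
  ultimately show False using m(3) by blast
qed

section \<open>The Galois group of a finite extension\<close>

context field_extension
begin

lemma galD:
  assumes "\<sigma> \<in> gal \<iota>"
  shows gal_hom: "field_hom \<sigma>" and gal_add: "\<sigma> (x + y) = \<sigma> x + \<sigma> y"
    and gal_mult: "\<sigma> (x * y) = \<sigma> x * \<sigma> y" and gal_one: "\<sigma> 1 = 1"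
    and gal_fix: "\<sigma> (\<iota> a) = \<iota> a" and gal_bij: "bij \<sigma>"
  using assms by (auto simp: gal_def field_hom_def)

lemma gal_zero: "\<sigma> \<in> gal \<iota> \<Longrightarrow> \<sigma> 0 = 0"
  using gal_fix[of \<sigma> 0] by simp

lemma gal_power: "\<sigma> \<in> gal \<iota> \<Longrightarrow> \<sigma> (x ^ k) = \<sigma> x ^ k"
  by (induction k) (auto simp: gal_mult gal_one)

lemma gal_sum: "\<sigma> \<in> gal \<iota> \<Longrightarrow> \<sigma> (sum f A) = (\<Sum>i\<in>A. \<sigma> (f i))"
  by (induction A rule: infinite_finite_induct) (auto simp: gal_add gal_zero)

lemma gal_id: "id \<in> gal \<iota>"
  by (auto simp: gal_def field_hom_def)

lemma gal_comp: "\<sigma> \<in> gal \<iota> \<Longrightarrow> \<tau> \<in> gal \<iota> \<Longrightarrow> \<sigma> \<circ> \<tau> \<in> gal \<iota>"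
  by (auto simp: gal_def field_hom_def intro: bij_comp)

lemma gal_inv:
  assumes "\<sigma> \<in> gal \<iota>"
  shows "inv \<sigma> \<in> gal \<iota>"
proof -
  have s: "surj \<sigma>" "inj \<sigma>" using gal_bij[OF assms] by (auto simp: bij_def)
  have "inv \<sigma> (x + y) = inv \<sigma> x + inv \<sigma> y" "inv \<sigma> (x * y) = inv \<sigma> x * inv \<sigma> y" for x y
    using s assms by (auto intro!: inv_f_eq simp: gal_add gal_mult surj_f_inv_f)
  moreover have "inv \<sigma> (\<iota> a) = \<iota> a" for a
    using s assms by (auto intro!: inv_f_eq simp: gal_fix)
  moreover have "inv \<sigma> 1 = 1"
    using s assms by (auto intro!: inv_f_eq simp: gal_one)
  ultimately show ?thesis
    using gal_bij[OF assms] by (auto simp: gal_def field_hom_def bij_imp_bij_inv)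
qed

lemma gal_funpow: "\<sigma> \<in> gal \<iota> \<Longrightarrow> \<sigma> ^^ k \<in> gal \<iota>"
  by (induction k) (auto simp: gal_id gal_comp)

lemma gal_comp_bij: "\<sigma> \<in> gal \<iota> \<Longrightarrow> bij_betw (\<lambda>\<tau>. \<sigma> \<circ> \<tau>) (gal \<iota>) (gal \<iota>)"
  by (rule bij_betw_byWitness[where f' = "\<lambda>\<tau>. inv \<sigma> \<circ> \<tau>"])
    (use gal_comp gal_inv gal_bij in \<open>auto simp: fun_eq_iff bij_is_inj bij_is_surj surj_f_inv_f\<close>)

lemma gal_eqI:
  assumes "\<sigma> \<in> gal \<iota>" "\<tau> \<in> gal \<iota>" "vs.span S = UNIV" "\<And>x. x \<in> S \<Longrightarrow> \<sigma> x = \<tau> x"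
  shows "\<sigma> = \<tau>"
proof
  fix x
  have "x \<in> vs.span S" using assms by simp
  then show "\<sigma> x = \<tau> x"
    by (induction rule: vs.span_induct_alt)
      (use assms in \<open>auto simp: gal_zero gal_add gal_mult gal_fix scale_of_def\<close>)
qed

text \<open>The powers of \<open>x\<close> up to exponent \<open>card B\<close> are one more than
  the dimension, and a dependence among them supplies the coefficients of \<open>q\<close>.\<close>

lemma algebraic:
  assumes B: "finite B" "is_basis \<iota> B"
  obtains q where "q \<noteq> 0" "\<And>i. coeff q i \<in> range \<iota>" "poly q x = 0"
proof -
  interpret fd: finite_dimensional_vector_space "scale_of \<iota>" B
    using B by unfold_locales (auto simp: is_basis_def)
  let ?N = "card B"
  let ?S = "(\<lambda>i. x ^ i) ` {..?N}"
  show thesis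
  proof (cases "inj_on (\<lambda>i. x ^ i) {..?N}")
    case True
    have "vs.dependent ?S"
    proof (rule ccontr)
      assume "vs.independent ?S"
      then have "card ?S \<le> vs.dim UNIV" by (intro fd.independent_card_le_dim) auto
      then show False using True by (simp add: card_image fd.dim_UNIV fd.dimension_def)
    qed
    then obtain u v where u: "v \<in> ?S" "u v \<noteq> 0" "(\<Sum>v\<in>?S. scale_of \<iota> (u v) v) = 0"
      by (auto simp: vs.dependent_finite)
    define q where "q = (\<Sum>i\<le>?N. monom (\<iota> (u (x ^ i))) i)"
    have cf: "coeff q i = (if i \<le> ?N then \<iota> (u (x ^ i)) else 0)" for i
      by (simp add: q_def coeff_sum)
    show thesis
    proof (rule that[of q])
      obtain i where "i \<le> ?N" "v = x ^ i" using u by auto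
      then have "coeff q i \<noteq> 0" using u by (simp add: cf)
      then show "q \<noteq> 0" by auto
      show "coeff q i \<in> range \<iota>" for i
        using hom_zero by (auto simp: cf simp del: hom_zero)
      show "poly q x = 0"
        using u(3) by (simp add: q_def poly_sum poly_monom sum.reindex[OF True] scale_of_def)
    qed
  next
    case False
    \<comment> \<open>When two powers coincide, the set of powers is too small for the dimension
      count, but \<open>X^i - X^j\<close> annihilates \<open>x\<close> directly.\<close>
    then obtain i j where ij: "x ^ i = x ^ j" "i \<noteq> j" by (auto simp: inj_on_def)
    show thesis
    proof (rule that[of "monom 1 i - monom 1 j"])
      have "coeff (monom 1 i - monom 1 j :: 'l poly) i \<noteq> 0" using ij by simp
      then show "monom 1 i - monom 1 j \<noteq> (0 :: 'l poly)" by (metis coeff_0)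
      have "1 - 0 \<in> range \<iota>" "0 - 1 \<in> range \<iota>" "0 \<in> range \<iota>"
        using hom_diff[of 1 0] hom_diff[of 0 1] hom_zero by (metis hom_one hom_zero rangeI)+
      then show "coeff (monom 1 i - monom 1 j) k \<in> range \<iota>" for k by auto
      show "poly (monom 1 i - monom 1 j) x = 0" using ij by (simp add: poly_monom)
    qed
  qed
qed

text \<open>An automorphism is determined by its values on the basis, and its value at
  \<open>b\<close> is a root of the polynomial \<open>q b\<close> over K annihilating
  \<open>b\<close>, so finitely many choices remain.\<close>

lemma finite_gal:
  assumes B: "finite B" "is_basis \<iota> B"
  shows "finite (gal \<iota>)"
proof -
  have "\<forall>b. \<exists>q. q \<noteq> 0 \<and> (\<forall>i. coeff q i \<in> range \<iota>) \<and> poly q b = 0"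
    using algebraic[OF B] by metis
  then obtain q where q: "\<And>b. q b \<noteq> 0" "\<And>b i. coeff (q b) i \<in> range \<iota>" "\<And>b. poly (q b) b = 0"
    by metis
  have root: "poly (q b) (\<sigma> b) = 0" if \<sigma>: "\<sigma> \<in> gal \<iota>" for \<sigma> b
  proof -
    have "\<sigma> (coeff (q b) i) = coeff (q b) i" for i
      using q(2)[where b = b and i = i] gal_fix[OF \<sigma>] by auto
    then have "poly (q b) (\<sigma> b) = \<sigma> (poly (q b) b)"
      by (simp add: poly_altdef gal_sum[OF \<sigma>] gal_mult[OF \<sigma>] gal_power[OF \<sigma>])
    then show ?thesis using q(3) gal_zero[OF \<sigma>] by simp
  qed
  have "inj_on (\<lambda>\<sigma>. restrict \<sigma> B) (gal \<iota>)"
  proof (rule inj_onI)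
    fix \<sigma> \<tau> assume st: "\<sigma> \<in> gal \<iota>" "\<tau> \<in> gal \<iota>" "restrict \<sigma> B = restrict \<tau> B"
    then have "\<sigma> b = \<tau> b" if "b \<in> B" for b using that by (metis restrict_apply')
    then show "\<sigma> = \<tau>" using gal_eqI[OF st(1,2), of B] B by (simp add: is_basis_def)
  qed
  moreover have "(\<lambda>\<sigma>. restrict \<sigma> B) ` gal \<iota> \<subseteq> (\<Pi>\<^sub>E b\<in>B. {z. poly (q b) z = 0})"
    using root by auto
  moreover have "finite (\<Pi>\<^sub>E b\<in>B. {z. poly (q b) z = 0})"
    using B q(1) by (intro finite_PiE) (auto intro: poly_roots_finite)
  ultimately show ?thesis by (meson finite_imageD finite_subset)
qed

end

section \<open>Kummer extensions and eigenvectors of the Galois group\<close>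

locale kummer = field_extension \<iota> for \<iota> :: "'k::field \<Rightarrow> 'l::field" +
  fixes m :: nat
  assumes kummer: "kummer_extension \<iota> m"
begin

abbreviation "G \<equiv> gal \<iota>"

lemma fixed_field: "(\<forall>\<sigma>\<in>G. \<sigma> x = x) \<longleftrightarrow> x \<in> range \<iota>"
  using kummer by (auto simp: kummer_extension_def galois_def)

lemma finite_G: "finite G"
  using kummer finite_gal by (auto simp: kummer_extension_def galois_def finite_extension_def)

lemma commute: "\<sigma> \<in> G \<Longrightarrow> \<tau> \<in> G \<Longrightarrow> \<sigma> (\<tau> x) = \<tau> (\<sigma> x)"
  using kummer unfolding kummer_extension_def by (metis comp_apply)

lemma funpow_exponent: "\<sigma> \<in> G \<Longrightarrow> \<sigma> ^^ m = id" and m_pos: "m > 0"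
  using kummer unfolding kummer_extension_def has_exponent_def by auto

definition \<zeta> :: 'k where "\<zeta> = (SOME z. primitive_root_of_unity m z)"

lemma primitive: "primitive_root_of_unity m \<zeta>"
  unfolding \<zeta>_def using kummer unfolding kummer_extension_def by (metis someI_ex)

lemma \<zeta>_power_m: "\<zeta> ^ m = 1"
  using primitive by (simp add: primitive_root_of_unity_def)

lemma \<zeta>_nonzero: "\<zeta> \<noteq> 0"
  using \<zeta>_power_m m_pos by (auto simp: power_0_left)

lemma \<zeta>_inj: "inj_on (\<lambda>i. \<zeta> ^ i) {..<m}"
proof (rule linorder_inj_onI')
  fix i j assume ij: "i \<in> {..<m}" "j \<in> {..<m}" "i < j"
  then have "\<zeta> ^ (j - i) \<noteq> 1" using primitive by (auto simp: primitive_root_of_unity_def)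
  then show "\<zeta> ^ i \<noteq> \<zeta> ^ j" using ij \<zeta>_nonzero by (simp add: power_diff)
qed

text \<open>The powers of \<open>\<zeta>\<close> below \<open>m\<close> exhaust the at most
  \<open>m\<close> roots of \<open>X^m - 1\<close>.\<close>

lemma root_of_unity_in_base:
  assumes "z ^ m = 1"
  obtains c where "z = \<iota> c"
proof -
  let ?q = "monom 1 m - 1 :: 'l poly"
  let ?R = "(\<lambda>i. \<iota> (\<zeta> ^ i)) ` {..<m}"
  have "coeff ?q m \<noteq> 0" using m_pos by simp
  then have q: "?q \<noteq> 0" by (metis coeff_0)
  have "degree ?q \<le> m" by (rule degree_diff_le) (auto simp: degree_monom_le)
  then have card_le: "card {z. poly ?q z = 0} \<le> m" using card_poly_roots_bound[OF q] by linarith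
  have roots: "?R \<subseteq> {z. poly ?q z = 0}"
  proof safe
    fix i
    have "\<zeta> ^ (i * m) = 1" using \<zeta>_power_m by (metis mult.commute power_mult power_one)
    then show "poly ?q (\<iota> (\<zeta> ^ i)) = 0"
      by (simp add: poly_monom flip: hom_power power_mult)
  qed
  have "card ?R = m" using \<zeta>_inj by (subst card_image) (auto simp: inj_on_def)
  then have "?R = {z. poly ?q z = 0}"
    using card_le by (intro card_seteq[OF poly_roots_finite[OF q] roots]) simp
  moreover have "z \<in> {z. poly ?q z = 0}" using assms by (simp add: poly_monom)
  ultimately show thesis using that by blast
qed

definition eigenvector :: "'l \<Rightarrow> bool" where
  "eigenvector y \<longleftrightarrow> y \<noteq> 0 \<and> (\<forall>\<sigma>\<in>G. \<exists>c. \<sigma> y = \<iota> c * y)"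

text \<open>Iterating \<open>\<sigma> y = \<iota> c * y\<close> up to
  \<open>\<sigma> ^^ m = id\<close> gives \<open>\<iota> c ^ m = 1\<close>, so
  \<open>\<sigma>\<close> fixes \<open>y ^ m\<close>. Conversely \<open>\<sigma> y / y\<close> is an
  \<open>m\<close>-th root of unity, hence in K.\<close>

lemma eigenvector_iff: "eigenvector y \<longleftrightarrow> y \<noteq> 0 \<and> y ^ m \<in> range \<iota>"
proof
  assume y: "eigenvector y"
  have "\<sigma> (y ^ m) = y ^ m" if \<sigma>: "\<sigma> \<in> G" for \<sigma>
  proof -
    obtain c where c: "\<sigma> y = \<iota> c * y" using y \<sigma> by (auto simp: eigenvector_def)
    have "(\<sigma> ^^ k) y = \<iota> c ^ k * y" for k
      by (induction k) (auto simp: gal_mult[OF \<sigma>] gal_power[OF \<sigma>] gal_fix[OF \<sigma>] c)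
    from this[of m] have "\<iota> c ^ m = 1" using funpow_exponent[OF \<sigma>] y by (simp add: eigenvector_def)
    then show ?thesis by (simp add: gal_power[OF \<sigma>] c power_mult_distrib)
  qed
  then show "y \<noteq> 0 \<and> y ^ m \<in> range \<iota>"
    using fixed_field[of "y ^ m"] y by (auto simp: eigenvector_def)
next
  assume y: "y \<noteq> 0 \<and> y ^ m \<in> range \<iota>"
  have "\<exists>c. \<sigma> y = \<iota> c * y" if \<sigma>: "\<sigma> \<in> G" for \<sigma>
  proof -
    have "\<sigma> y ^ m = y ^ m" using y \<sigma> fixed_field[of "y ^ m"] by (simp flip: gal_power[OF \<sigma>])
    then have "(\<sigma> y / y) ^ m = 1" using y by (simp add: power_divide)
    then obtain c where "\<sigma> y / y = \<iota> c" by (rule root_of_unity_in_base)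
    then show ?thesis using y by (auto simp: field_simps)
  qed
  then show "eigenvector y" using y by (simp add: eigenvector_def)
qed

lemma eigenvector_inverse: "eigenvector y \<Longrightarrow> eigenvector (inverse y)"
  unfolding eigenvector_iff by (auto simp: power_inverse simp flip: hom_inverse)

text \<open>A discrete Fourier transform over the powers of \<open>\<sigma>\<close>:
  \<open>p i\<close> projects onto the eigenspace for \<open>inverse (\<zeta> ^ i)\<close>.\<close>

lemma eigenprojections:
  assumes \<sigma>: "\<sigma> \<in> G"
  defines "p \<equiv> \<lambda>i x. \<Sum>j<m. \<iota> (\<zeta> ^ (i * j) / of_nat m) * (\<sigma> ^^ j) x"
  shows "\<sigma> (p i x) = \<iota> (inverse (\<zeta> ^ i)) * p i x" and "(\<Sum>i<m. p i x) = x"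
proof -
  \<comment> \<open>Term \<open>m\<close> of the sum equals term \<open>0\<close>, so the index
    shift caused by \<open>\<sigma>\<close> is cyclic.\<close>
  have per: "\<iota> (\<zeta> ^ (i * m) / of_nat m) * (\<sigma> ^^ m) x = \<iota> (\<zeta> ^ (i * 0) / of_nat m) * (\<sigma> ^^ 0) x"
    using funpow_exponent[OF \<sigma>] \<zeta>_power_m by (simp add: power_mult mult.commute[of i])
  have "\<iota> (\<zeta> ^ i) * \<sigma> (p i x) = (\<Sum>j<m. \<iota> (\<zeta> ^ (i * Suc j) / of_nat m) * (\<sigma> ^^ Suc j) x)"
    unfolding p_def gal_sum[OF \<sigma>] sum_distrib_left
    by (rule sum.cong[OF refl],
        simp only: gal_mult[OF \<sigma>] gal_fix[OF \<sigma>] mult.assoc[symmetric] hom_mult[symmetric])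
      (simp add: power_add)
  also have "\<dots> = (\<Sum>j<Suc m. \<iota> (\<zeta> ^ (i * j) / of_nat m) * (\<sigma> ^^ j) x)
      - \<iota> (\<zeta> ^ (i * 0) / of_nat m) * (\<sigma> ^^ 0) x"
    by (subst sum.lessThan_Suc_shift) simp
  also have "\<dots> = p i x"
    unfolding sum.lessThan_Suc per p_def by simp
  finally have "\<iota> (inverse (\<zeta> ^ i)) * (\<iota> (\<zeta> ^ i) * \<sigma> (p i x)) = \<iota> (inverse (\<zeta> ^ i)) * p i x"
    by (rule arg_cong)
  moreover have "\<iota> (inverse (\<zeta> ^ i)) * \<iota> (\<zeta> ^ i) = 1"
    using \<zeta>_nonzero by (simp flip: hom_mult)
  ultimately show "\<sigma> (p i x) = \<iota> (inverse (\<zeta> ^ i)) * p i x"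
    by (simp only: mult.assoc[symmetric]) simp
  \<comment> \<open>For \<open>0 < j < m\<close> the geometric sum of the powers of
    \<open>\<zeta> ^ j\<close> vanishes; hence only the identity, at \<open>j = 0\<close>, survives
    in the sum of the projections.\<close>
  have orth: "(\<Sum>i<m. \<zeta> ^ (i * j) / of_nat m) = (if j = 0 then 1 else 0)" if "j < m" for j
  proof (cases "j = 0")
    case True
    then show ?thesis using primitive_root_of_nat_nonzero[OF primitive] by simp
  next
    case False
    then have "\<zeta> ^ j \<noteq> 1" using that primitive by (auto simp: primitive_root_of_unity_def)
    moreover have "(\<Sum>i<m. (\<zeta> ^ j) ^ i) * (1 - \<zeta> ^ j) = 1 - (\<zeta> ^ j) ^ m"
      using sum_gp_strict[of "\<zeta> ^ j" m] by auto
    moreover have "(\<zeta> ^ j) ^ m = 1" using \<zeta>_power_m by (metis mult.commute power_mult power_one)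
    ultimately have "(\<Sum>i<m. (\<zeta> ^ j) ^ i) = 0" by simp
    then show ?thesis using False
      by (simp add: mult.commute[of _ j] power_mult flip: sum_divide_distrib)
  qed
  have "(\<Sum>i<m. p i x) = (\<Sum>j<m. \<iota> (\<Sum>i<m. \<zeta> ^ (i * j) / of_nat m) * (\<sigma> ^^ j) x)"
    unfolding p_def by (subst sum.swap) (simp add: hom_sum sum_distrib_right)
  also have "\<dots> = (\<Sum>j<m. (if j = 0 then x else 0))"
    by (rule sum.cong) (auto simp: orth)
  also have "\<dots> = x" using m_pos by simp
  finally show "(\<Sum>i<m. p i x) = x" .
qed

text \<open>Simultaneous diagonalization, one automorphism at a time.\<close>

lemma span_common_eigenvectors:
  assumes "finite F" "F \<subseteq> G"
  shows "vs.span {x. \<forall>\<sigma>\<in>F. \<exists>c. \<sigma> x = \<iota> c * x} = UNIV"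
  using assms
proof (induction F rule: finite_induct)
  case (insert \<sigma> F)
  define E where "E = {x. \<forall>\<sigma>\<in>F. \<exists>c. \<sigma> x = \<iota> c * x}"
  define E' where "E' = {x. \<forall>\<sigma>\<in>insert \<sigma> F. \<exists>c. \<sigma> x = \<iota> c * x}"
  have \<sigma>: "\<sigma> \<in> G" using insert by auto
  have "E \<subseteq> vs.span E'"
  proof
    fix x assume x: "x \<in> E"
    define p where "p i = (\<Sum>j<m. \<iota> (\<zeta> ^ (i * j) / of_nat m) * (\<sigma> ^^ j) x)" for i
    have p: "\<sigma> (p i) = \<iota> (inverse (\<zeta> ^ i)) * p i" "(\<Sum>i<m. p i) = x" for i
      unfolding p_def using eigenprojections[OF \<sigma>] by auto
    \<comment> \<open>As \<open>G\<close> is abelian, the components of \<open>x\<close> under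
      \<open>\<sigma>\<close> keep the eigenvalues of \<open>x\<close> under the automorphisms in
      \<open>F\<close>.\<close>
    have "\<exists>c. \<tau> (p i) = \<iota> c * p i" if \<tau>F: "\<tau> \<in> F" for \<tau> i
    proof -
      obtain c where c: "\<tau> x = \<iota> c * x" using x \<tau>F by (auto simp: E_def)
      have \<tau>: "\<tau> \<in> G" using \<tau>F insert by auto
      have "\<tau> (p i) = (\<Sum>j<m. \<iota> (\<zeta> ^ (i * j) / of_nat m) * (\<sigma> ^^ j) (\<tau> x))"
        using commute[OF \<tau> gal_funpow[OF \<sigma>]]
        by (simp add: p_def gal_sum[OF \<tau>] gal_mult[OF \<tau>] gal_fix[OF \<tau>])
      also have "\<dots> = \<iota> c * p i"
        unfolding c p_def sum_distrib_left
        by (rule sum.cong) (auto simp: gal_mult[OF gal_funpow[OF \<sigma>]] gal_fix[OF gal_funpow[OF \<sigma>]])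
      finally show ?thesis by blast
    qed
    then have "p i \<in> E'" for i using p(1) by (auto simp: E'_def)
    then have "(\<Sum>i<m. p i) \<in> vs.span E'" by (intro vs.span_sum vs.span_base)
    then show "x \<in> vs.span E'" by (simp add: p)
  qed
  then have "vs.span E \<subseteq> vs.span E'" by (intro vs.span_minimal vs.subspace_span)
  then show ?case using insert by (auto simp: E_def E'_def)
qed (auto simp: vs.span_UNIV)

lemma span_eigenvectors: "vs.span {y. eigenvector y} = UNIV"
proof -
  have "{x. \<forall>\<sigma>\<in>G. \<exists>c. \<sigma> x = \<iota> c * x} \<subseteq> vs.span {y. eigenvector y}"
  proof
    fix x assume "x \<in> {x. \<forall>\<sigma>\<in>G. \<exists>c. \<sigma> x = \<iota> c * x}"
    then have "x = 0 \<or> eigenvector x" by (simp add: eigenvector_def)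
    then show "x \<in> vs.span {y. eigenvector y}" using vs.span_zero vs.span_base by blast
  qed
  then have "vs.span {x. \<forall>\<sigma>\<in>G. \<exists>c. \<sigma> x = \<iota> c * x} \<subseteq> vs.span {y. eigenvector y}"
    by (intro vs.span_minimal vs.subspace_span)
  then show ?thesis using span_common_eigenvectors[OF finite_G] by auto
qed

section \<open>The trace and normal elements\<close>

lemma trace_in_base: "gal_trace \<iota> x \<in> range \<iota>"
proof -
  have "\<sigma> (gal_trace \<iota> x) = gal_trace \<iota> x" if \<sigma>: "\<sigma> \<in> G" for \<sigma>
    unfolding gal_trace_def gal_sum[OF \<sigma>]
    using sum.reindex_bij_betw[OF gal_comp_bij[OF \<sigma>], of "\<lambda>\<tau>. \<tau> x"] by simp
  then show ?thesis using fixed_field by blast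
qed

lemma trace_nonzero: "\<exists>x. gal_trace \<iota> x \<noteq> 0"
proof (rule ccontr)
  assume "\<nexists>x. gal_trace \<iota> x \<noteq> 0"
  then have "(\<Sum>\<sigma>\<in>G. 1 * \<sigma> x) = 0" for x by (simp add: gal_trace_def)
  then have "(1::'l) = 0"
    using dedekind_independence[OF finite_G, of "\<lambda>_. 1" id] gal_hom gal_id by blast
  then show False by simp
qed

lemma trace_add: "gal_trace \<iota> (x + y) = gal_trace \<iota> x + gal_trace \<iota> y"
  unfolding gal_trace_def sum.distrib[symmetric] by (rule sum.cong) (auto simp: gal_add)

lemma trace_scale: "gal_trace \<iota> (\<iota> a * x) = \<iota> a * gal_trace \<iota> x"
  unfolding gal_trace_def sum_distrib_left by (rule sum.cong) (auto simp: gal_mult gal_fix)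

text \<open>Pulling \<open>y\<close> out of each conjugate of \<open>x * y\<close> leaves a
  K-combination of conjugates of \<open>x\<close> with the eigenvalues of \<open>y\<close> as
  coefficients. As \<open>c id\<close> is nonzero, a vanishing trace is a nontrivial relation
  between these conjugates.\<close>

lemma eigenvector_trace:
  assumes "eigenvector y"
  obtains c where "\<And>x. gal_trace \<iota> (x * y) = y * (\<Sum>\<sigma>\<in>G. \<iota> (c \<sigma>) * \<sigma> x)" "c id \<noteq> 0"
proof -
  obtain c where c: "\<And>\<sigma>. \<sigma> \<in> G \<Longrightarrow> \<sigma> y = \<iota> (c \<sigma>) * y"
    using assms unfolding eigenvector_def by metis
  have y: "y \<noteq> 0" using assms by (simp add: eigenvector_def)
  show thesis
  proof (rule that)
    show "gal_trace \<iota> (x * y) = y * (\<Sum>\<sigma>\<in>G. \<iota> (c \<sigma>) * \<sigma> x)" for x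
      unfolding gal_trace_def sum_distrib_left by (rule sum.cong) (auto simp: gal_mult c)
    show "c id \<noteq> 0" using c[OF gal_id] y by auto
  qed
qed

text \<open>If \<open>\<sigma>\<close> and \<open>\<tau>\<close> agree at \<open>x\<close>,
  commutativity makes them agree at every conjugate of \<open>x\<close>, hence on the span. This
  turns sums over the set of conjugates into sums over \<open>G\<close>.\<close>

lemma conjugates_inj:
  assumes "vs.span ((\<lambda>\<sigma>. \<sigma> x) ` G) = UNIV"
  shows "inj_on (\<lambda>\<sigma>. \<sigma> x) G"
proof (rule inj_onI)
  fix \<sigma> \<tau> assume st: "\<sigma> \<in> G" "\<tau> \<in> G" "\<sigma> x = \<tau> x"
  show "\<sigma> = \<tau>"
  proof (rule gal_eqI[OF st(1,2) assms])
    fix z assume "z \<in> (\<lambda>\<sigma>. \<sigma> x) ` G"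
    then obtain \<rho> where "\<rho> \<in> G" "z = \<rho> x" by auto
    then show "\<sigma> z = \<tau> z" using st commute by metis
  qed
qed

lemma normal_over_iff_trace:
  "normal_over \<iota> x \<longleftrightarrow> (\<forall>y. eigenvector y \<longrightarrow> gal_trace \<iota> (x * y) \<noteq> 0)"
proof
  let ?C = "(\<lambda>\<sigma>. \<sigma> x) ` G"
  assume normal: "normal_over \<iota> x"
  then have indep: "vs.independent ?C" and span: "vs.span ?C = UNIV"
    by (auto simp: normal_over_def is_basis_def)
  have inj: "inj_on (\<lambda>\<sigma>. \<sigma> x) G" by (rule conjugates_inj[OF span])
  show "\<forall>y. eigenvector y \<longrightarrow> gal_trace \<iota> (x * y) \<noteq> 0"
  proof (intro allI impI notI)
    fix y assume y: "eigenvector y" and tr: "gal_trace \<iota> (x * y) = 0"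
    obtain c where c: "\<And>x. gal_trace \<iota> (x * y) = y * (\<Sum>\<sigma>\<in>G. \<iota> (c \<sigma>) * \<sigma> x)" "c id \<noteq> 0"
      using eigenvector_trace[OF y] by metis
    define u where "u z = c (the_inv_into G (\<lambda>\<sigma>. \<sigma> x) z)" for z
    have u: "u (\<sigma> x) = c \<sigma>" if "\<sigma> \<in> G" for \<sigma>
      using the_inv_into_f_f[OF inj that] by (simp add: u_def)
    have "(\<Sum>\<sigma>\<in>G. \<iota> (c \<sigma>) * \<sigma> x) = 0" using c(1) tr y by (auto simp: eigenvector_def)
    then have "(\<Sum>z\<in>?C. scale_of \<iota> (u z) z) = 0"
      by (simp add: sum.reindex[OF inj] scale_of_def u)
    moreover have "id x \<in> ?C" using gal_id by (rule imageI)
    ultimately have "u (id x) = 0"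
      using vs.independentD[OF indep, of ?C u "id x"] finite_G by blast
    then show False using u[OF gal_id] c(2) by simp
  qed
next
  let ?C = "(\<lambda>\<sigma>. \<sigma> x) ` G"
  assume tr: "\<forall>y. eigenvector y \<longrightarrow> gal_trace \<iota> (x * y) \<noteq> 0"
  have "{y. eigenvector y} \<subseteq> vs.span ?C"
  proof safe
    fix y assume y: "eigenvector y"
    then have y0: "y \<noteq> 0" by (simp add: eigenvector_def)
    obtain c where c: "\<And>x. gal_trace \<iota> (x * inverse y) = inverse y * (\<Sum>\<sigma>\<in>G. \<iota> (c \<sigma>) * \<sigma> x)"
      using eigenvector_trace[OF eigenvector_inverse[OF y]] by metis
    obtain t where t: "gal_trace \<iota> (x * inverse y) = \<iota> t" using trace_in_base by (metis imageE)
    have t0: "t \<noteq> 0" using t tr eigenvector_inverse[OF y] by (metis hom_zero)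
    \<comment> \<open>The nonzero trace against \<open>inverse y\<close> exhibits a nonzero
      K-multiple of \<open>y\<close> as a combination of the conjugates of \<open>x\<close>.\<close>
    have "(\<Sum>\<sigma>\<in>G. \<iota> (c \<sigma>) * \<sigma> x) = \<iota> t * y" using c[of x] t y0 by (simp add: field_simps)
    then have "y = scale_of \<iota> (inverse t) (\<Sum>\<sigma>\<in>G. scale_of \<iota> (c \<sigma>) (\<sigma> x))"
      using t0 by (simp add: scale_of_def hom_inverse)
    moreover have "scale_of \<iota> (inverse t) (\<Sum>\<sigma>\<in>G. scale_of \<iota> (c \<sigma>) (\<sigma> x)) \<in> vs.span ?C"
      by (intro vs.span_scale vs.span_sum vs.span_base) auto
    ultimately show "y \<in> vs.span ?C" by simp
  qed
  then have "vs.span {y. eigenvector y} \<subseteq> vs.span ?C" by (intro vs.span_minimal vs.subspace_span)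
  then have span: "vs.span ?C = UNIV" using span_eigenvectors by auto
  have inj: "inj_on (\<lambda>\<sigma>. \<sigma> x) G" by (rule conjugates_inj[OF span])
  have "vs.independent ?C"
  proof (rule vs.independent_if_scalars_zero)
    fix f z assume "(\<Sum>z\<in>?C. scale_of \<iota> (f z) z) = 0" and z: "z \<in> ?C"
    then have rel: "(\<Sum>\<sigma>\<in>G. \<iota> (f (\<sigma> x)) * \<sigma> x) = 0"
      by (simp add: sum.reindex[OF inj] scale_of_def)
    \<comment> \<open>As \<open>G\<close> is abelian, the operator killing \<open>x\<close> kills its conjugates, hence everything.\<close>
    have zero: "(\<Sum>\<sigma>\<in>G. \<iota> (f (\<sigma> x)) * \<sigma> w) = 0" for w
    proof -
      have "w \<in> vs.span ?C" using span by simp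
      then show ?thesis
      proof (induction rule: vs.span_induct_alt)
        case base
        then show ?case by (simp add: gal_zero)
      next
        case (step a y w)
        then obtain \<rho> where \<rho>: "\<rho> \<in> G" "y = \<rho> x" by auto
        have "(\<Sum>\<sigma>\<in>G. \<iota> (f (\<sigma> x)) * \<sigma> y) = \<rho> (\<Sum>\<sigma>\<in>G. \<iota> (f (\<sigma> x)) * \<sigma> x)"
          unfolding gal_sum[OF \<rho>(1)] \<rho>(2)
          by (rule sum.cong) (use commute \<rho> in \<open>auto simp: gal_mult gal_fix\<close>)
        then have y0: "(\<Sum>\<sigma>\<in>G. \<iota> (f (\<sigma> x)) * \<sigma> y) = 0" using rel gal_zero[OF \<rho>(1)] by simp
        have "(\<Sum>\<sigma>\<in>G. \<iota> (f (\<sigma> x)) * \<sigma> (scale_of \<iota> a y + w))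
            = \<iota> a * (\<Sum>\<sigma>\<in>G. \<iota> (f (\<sigma> x)) * \<sigma> y) + (\<Sum>\<sigma>\<in>G. \<iota> (f (\<sigma> x)) * \<sigma> w)"
          unfolding sum_distrib_left sum.distrib[symmetric]
          by (rule sum.cong) (auto simp: gal_add gal_mult gal_fix scale_of_def algebra_simps)
        then show ?case using step y0 by simp
      qed
    qed
    obtain \<sigma> where \<sigma>: "\<sigma> \<in> G" "z = \<sigma> x" using z by auto
    have "\<iota> (f (\<sigma> x)) = 0"
      using dedekind_independence[OF finite_G, of "\<lambda>\<sigma>. \<iota> (f (\<sigma> x))" \<sigma>] zero gal_hom \<sigma> by blast
    then show "f z = 0" using \<sigma> by simp
  qed (use finite_G in auto)
  then show "normal_over \<iota> x" using span by (simp add: normal_over_def is_basis_def)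
qed

end

section \<open>The different, unit roots and the valuation criterion\<close>

locale totally_ramified_kummer = totally_ramified_extension \<iota> vK vL n B + kummer \<iota> m
  for \<iota> :: "'k::field \<Rightarrow> 'l::field" and vK vL n B m
begin

lemma ramification_index_eq: "ramification_index vK vL \<iota> = int n"
  unfolding ramification_index_def
proof (rule the_equality)
  fix e assume e: "\<forall>a. a \<noteq> 0 \<longrightarrow> vL (\<iota> a) = e * vK a"
  obtain a where "a \<noteq> 0" "vK a = 1" by (rule K.obtain_val)
  then show "e = int n" using e val_ext[of a] by simp
qed (simp add: val_ext)

lemma different_exponent_spec:
  defines "d \<equiv> different_exponent vK vL \<iota>"
  shows "x \<noteq> 0 \<Longrightarrow> [vL x = - d - 1] (mod int n) \<Longrightarrow> gal_trace \<iota> x \<noteq> 0"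
    and "\<not> [j = - d - 1] (mod int n) \<Longrightarrow> \<exists>z. z \<noteq> 0 \<and> vL z = j \<and> gal_trace \<iota> z = 0"
proof -
  \<comment> \<open>The trace has values in L; \<open>T\<close> pulls it back along
    \<open>\<iota>\<close> to a K-valued functional, to which \<open>functional_exponent\<close>
    applies.\<close>
  define T where "T x = inv \<iota> (gal_trace \<iota> x)" for x
  have T: "\<iota> (T x) = gal_trace \<iota> x" for x
    unfolding T_def using trace_in_base by (rule f_inv_into_f)
  have T_eq_0: "T x = 0 \<longleftrightarrow> gal_trace \<iota> x = 0" for x
    by (metis T hom_eq_0_iff)
  have "\<iota> (T (x + y)) = \<iota> (T x + T y)" "\<iota> (T (\<iota> a * x)) = \<iota> (a * T x)" for x y a
    by (simp_all only: T trace_add trace_scale hom_add hom_mult)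
  then have add: "T (x + y) = T x + T y" and scale: "T (\<iota> a * x) = a * T x" for x y a
    by (simp_all only: hom_eq_iff)
  obtain x0 where x0: "T x0 \<noteq> 0" using trace_nonzero T_eq_0 by blast
  obtain d' where
    C: "{x. \<forall>y\<in>val_ring vL. T (x * y) \<in> val_ring vK} = val_ideal vL (- d')"
    and *: "\<And>x. x \<noteq> 0 \<Longrightarrow> [vL x = - d' - 1] (mod int n) \<Longrightarrow> T x \<noteq> 0"
    "\<And>j. \<not> [j = - d' - 1] (mod int n) \<Longrightarrow> \<exists>z. z \<noteq> 0 \<and> vL z = j \<and> T z = 0"
    by (rule functional_exponent[of T, OF add scale x0]) blast
  have "gal_trace \<iota> z \<in> \<iota> ` val_ring vK \<longleftrightarrow> T z \<in> val_ring vK" for z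
    unfolding T[symmetric] by auto
  then have codiff: "codifferent vK vL \<iota> = val_ideal vL (- d')"
    using C by (simp add: codifferent_def)
  have "different vK vL \<iota> = val_ideal vL d'"
  proof (intro set_eqI iffI)
    fix z assume z: "z \<in> different vK vL \<iota>"
    obtain x where x: "x \<noteq> 0" "vL x = - d'" by (rule L.obtain_val)
    then have "z * x \<in> val_ring vL" using z codiff by (auto simp: different_def val_ideal_def)
    then show "z \<in> val_ideal vL d'"
      using x by (cases "z = 0") (auto simp: val_ideal_def L.val_mult)
  next
    fix z assume "z \<in> val_ideal vL d'"
    then show "z \<in> different vK vL \<iota>"
      using L.val_ideal_mult[of z d' _ "- d'"] codiff by (auto simp: different_def)
  qed
  then have "d = d'"
    unfolding d_def different_exponent_def by (auto simp: L.val_ideal_eq_iff)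
  then show "x \<noteq> 0 \<Longrightarrow> [vL x = - d - 1] (mod int n) \<Longrightarrow> gal_trace \<iota> x \<noteq> 0"
    and "\<not> [j = - d - 1] (mod int n) \<Longrightarrow> \<exists>z. z \<noteq> 0 \<and> vL z = j \<and> gal_trace \<iota> z = 0"
    using * by (simp_all add: T_eq_0)
qed

text \<open>By \<open>eigenvector_iff\<close> the eigenvectors are the \<open>m\<close>-th roots in
  L of elements of the Kummer group, and \<open>\<iota> a = y ^ m\<close> gives
  \<open>int n * vK a = int m * vL y\<close>.\<close>

lemma unit_root_iff:
  "unit_root_kummer_extension vK \<iota> m \<longleftrightarrow> (\<forall>y. eigenvector y \<longrightarrow> int n dvd vL y)"
proof -
  have dvd_iff: "int m dvd vK a \<longleftrightarrow> int n dvd vL y" if "a \<noteq> 0" "y \<noteq> 0" "\<iota> a = y ^ m" for a y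
  proof -
    have eq: "int n * vK a = int m * vL y"
      using that val_ext[of a] by (simp add: L.val_power)
    have "int m dvd vK a \<longleftrightarrow> int n * int m dvd int n * vK a" using n_pos by simp
    also have "\<dots> \<longleftrightarrow> int m * int n dvd int m * vL y" by (simp add: eq mult.commute)
    also have "\<dots> \<longleftrightarrow> int n dvd vL y" using m_pos by simp
    finally show ?thesis .
  qed
  have "unit_root_kummer_extension vK \<iota> m \<longleftrightarrow> (\<forall>a\<in>kummer_group \<iota> m. int m dvd vK a)"
    using kummer by (auto simp: unit_root_kummer_extension_def)
  also have "\<dots> \<longleftrightarrow> (\<forall>y. eigenvector y \<longrightarrow> int n dvd vL y)"
  proof safe
    fix y assume all: "\<forall>a\<in>kummer_group \<iota> m. int m dvd vK a" and "eigenvector y"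
    then obtain a where a: "y \<noteq> 0" "\<iota> a = y ^ m" by (auto simp: eigenvector_iff)
    then have "a \<noteq> 0" by auto
    then show "int n dvd vL y" using dvd_iff a all by (auto simp: kummer_group_def)
  next
    fix a assume all: "\<forall>y. eigenvector y \<longrightarrow> int n dvd vL y" and "a \<in> kummer_group \<iota> m"
    then obtain y where y: "a \<noteq> 0" "y \<noteq> 0" "\<iota> a = y ^ m" by (auto simp: kummer_group_def)
    then have "eigenvector y" unfolding eigenvector_iff by (metis rangeI)
    then show "int m dvd vK a" using dvd_iff y all by blast
  qed
  finally show ?thesis .
qed

lemma VC_iff_unit_root: "VC vK vL \<iota> \<longleftrightarrow> unit_root_kummer_extension vK \<iota> m"
proof -
  define d where "d = different_exponent vK vL \<iota>"
  have VC: "VC vK vL \<iota> \<longleftrightarrow> (\<forall>x. x \<noteq> 0 \<and> [vL x = - d - 1] (mod int n) \<longrightarrow>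
      (\<forall>y. eigenvector y \<longrightarrow> gal_trace \<iota> (x * y) \<noteq> 0))"
    by (simp add: VC_def ramification_index_eq d_def normal_over_iff_trace)
  \<comment> \<open>Used with \<open>b = vL y\<close>: multiplication by \<open>y\<close> preserves
    the class of \<open>- d - 1\<close> exactly when \<open>n\<close> divides
    \<open>vL y\<close>.\<close>
  have shift: "[a + b = c] (mod int n) \<longleftrightarrow> int n dvd b" if "[a = c] (mod int n)" for a b c
  proof -
    have "[a + b = c] (mod int n) \<longleftrightarrow> [a + b = a + 0] (mod int n)"
      using that by (metis add.right_neutral cong_sym cong_trans)
    also have "\<dots> \<longleftrightarrow> int n dvd b" by (simp add: cong_0_iff cong_add_lcancel_0)
    finally show ?thesis .
  qed
  show ?thesis
    unfolding VC unit_root_iff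
  proof safe
    fix y assume all: "\<forall>x. x \<noteq> 0 \<and> [vL x = - d - 1] (mod int n) \<longrightarrow>
      (\<forall>y. eigenvector y \<longrightarrow> gal_trace \<iota> (x * y) \<noteq> 0)" and y: "eigenvector y"
    show "int n dvd vL y"
    proof (rule ccontr)
      assume "\<not> int n dvd vL y"
      then have "\<not> [- d - 1 + vL y = - d - 1] (mod int n)" by (simp add: shift)
      \<comment> \<open>The quotient \<open>z / y\<close> has valuation \<open>- d - 1\<close>, yet
        its product with the eigenvector \<open>y\<close> has trace \<open>0\<close>, contradicting
        \<open>all\<close>.\<close>
      then obtain z where z: "z \<noteq> 0" "vL z = - d - 1 + vL y" "gal_trace \<iota> z = 0"
        using different_exponent_spec(2) unfolding d_def by metis
      have y0: "y \<noteq> 0" using y by (simp add: eigenvector_def)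
      then have "vL (z / y) = - d - 1" using z by (simp add: L.val_divide)
      moreover have "z / y \<noteq> 0" using z y0 by simp
      ultimately have "gal_trace \<iota> (z / y * y) \<noteq> 0" using all y cong_refl by metis
      then show False using z y0 by simp
    qed
  next
    fix x y assume "\<forall>y. eigenvector y \<longrightarrow> int n dvd vL y"
      and x: "x \<noteq> 0" "[vL x = - d - 1] (mod int n)"
      and y: "eigenvector y" and tr: "gal_trace \<iota> (x * y) = 0"
    then have "[vL x + vL y = - d - 1] (mod int n)" using shift by blast
    moreover have "y \<noteq> 0" using y by (simp add: eigenvector_def)
    ultimately have "gal_trace \<iota> (x * y) \<noteq> 0"
      using x different_exponent_spec(1)[of "x * y"] by (simp add: L.val_mult d_def)
    then show False using tr by simp
  qed
qed

end

theorem theorem1: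
  fixes vK :: "'k::field \<Rightarrow> int" and vL :: "'l::field \<Rightarrow> int" and \<iota> :: "'k \<Rightarrow> 'l"
    and m r :: nat
  assumes "local_field_extension vK vL \<iota>"
    and "kummer_extension \<iota> m"
    and "totally_ramified vK vL \<iota>"
    and "ext_degree \<iota> = residue_char vK ^ r"
  shows "VC vK vL \<iota> \<longleftrightarrow> unit_root_kummer_extension vK \<iota> m"
proof -
  have "local_field vK" "local_field vL" and fin: "finite_extension \<iota>"
    using assms(1) by (auto simp: local_field_extension_def)
  then interpret K: normalized_discrete_valuation vK + L: normalized_discrete_valuation vL
    by (auto simp: local_field_def)
  interpret field_extension \<iota> using fin by unfold_locales (simp add: finite_extension_def)
  obtain e where e: "e > 0" "\<forall>a. a \<noteq> 0 \<longrightarrow> vL (\<iota> a) = e * vK a"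
    using assms(1) by (auto simp: local_field_extension_def)
  obtain a where a: "a \<noteq> 0" "vK a = 1" by (rule K.obtain_val)
  \<comment> \<open>As \<open>vK\<close> attains \<open>1\<close>, the factor \<open>e\<close> is
    unique; total ramification then identifies it with the degree.\<close>
  have "ramification_index vK vL \<iota> = e"
    unfolding ramification_index_def
  proof (rule the_equality)
    fix e' assume "\<forall>a. a \<noteq> 0 \<longrightarrow> vL (\<iota> a) = e' * vK a"
    then show "e' = e" using a e by (metis mult.right_neutral)
  qed (use e in blast)
  then have e_eq: "e = int (ext_degree \<iota>)"
    using assms(3) by (simp add: totally_ramified_def)
  obtain B where B: "finite B" "is_basis \<iota> B" using fin by (auto simp: finite_extension_def)
  then have "card B = ext_degree \<iota>"
    using vs.dim_eq_card[of B UNIV] by (simp add: is_basis_def ext_degree_def vs.span_UNIV)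
  then interpret totally_ramified_kummer \<iota> vK vL "ext_degree \<iota>" B m
    using e e_eq B assms(2) by unfold_locales auto
  show ?thesis by (rule VC_iff_unit_root)
qed

end
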